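(* For $m\ge2$, let $$H_m=\sqrt2\left\{-\frac1m\sum_{i=1}^{m-1} i\,\tilde B^i(1)+\max_{0\le t_1\le\cdots\le t_{m-1}\le1}\ \sum_{i=1}^{m-1}\tilde B^i(t_i)\right\},$$ and let $H_1\equiv0$ a.s., where $(\tilde B^1(t),\dots,\tilde B^{m-1}(t))$ is an $(m-1)$-dimensional Brownian motion with covariance matrix $tM$, where $M$ is the $(m-1)\times(m-1)$ tridiagonal matrix with $M_{i,i}=1$, $M_{i,i+1}=M_{i+1,i}=-1/2$ and all other entries $0$. Let $$D_m=\max_{0=t_0\le t_1\le\cdots\le t_{m-1}\le t_m=1}\ \sum_{i=1}^m\left[B^i(t_i)-B^i(t_{i-1})\right],$$ where $(B^1(t),\dots,B^m(t))$ is a standard $m$-dimensional Brownian motion. Then $D_m=Z_m+H_m$ a.s., where $Z_m$ is a centered normal random variable with variance $1/m$, and in fact is given by $Z_m=\frac1m\sum_{i=1}^m B^i(1)$.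
   Context: All Brownian motions are indexed by $0\le t\le1$ and start at $0$. A standard $m$-dimensional Brownian motion is a vector of $m$ independent standard one-dimensional Brownian motions (variance $t$ at time $t$). More generally, a multidimensional Brownian motion is a linear transformation of a standard one. The underlying probability space is assumed rich enough for all the Brownian motions considered to be defined on it. *)

theory Defs
  imports "HOL-Probability.Probability"
begin

context prob_space
begin

text \<open>
  Processes have type \<open>real \<Rightarrow> 'a \<Rightarrow> real\<close> (time first); only times in \<open>{0..1}\<close> matter.
  As usual, the start at 0 and the continuity of the paths are required almost surely.
\<close>

definition std_brownian :: "(real \<Rightarrow> 'a \<Rightarrow> real) \<Rightarrow> bool" where
  "std_brownian W \<longleftrightarrow>
     (\<forall>t\<in>{0..1}. random_variable borel (W t)) \<and>
     (AE \<omega> in M. W 0 \<omega> = 0 \<and> continuous_on {0..1} (\<lambda>t. W t \<omega>)) \<and>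
     (\<forall>s t. 0 \<le> s \<and> s < t \<and> t \<le> 1 \<longrightarrow>
        distributed M lborel (\<lambda>\<omega>. W t \<omega> - W s \<omega>) (normal_density 0 (sqrt (t - s)))) \<and>
     (\<forall>n (t :: nat \<Rightarrow> real). (\<forall>k\<le>n. t k \<in> {0..1}) \<and> (\<forall>k<n. t k \<le> t (Suc k)) \<longrightarrow>
        indep_vars (\<lambda>_. borel) (\<lambda>k \<omega>. W (t (Suc k)) \<omega> - W (t k) \<omega>) {..<n})"

text \<open>
  Components are indexed by \<open>1, \<dots>, d\<close>. They are independent as processes, i.e. as random
  elements of the space of functions on \<open>{0..1}\<close> with its product sigma-algebra.
\<close>

definition std_brownian_dim :: "nat \<Rightarrow> (nat \<Rightarrow> real \<Rightarrow> 'a \<Rightarrow> real) \<Rightarrow> bool" where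
  "std_brownian_dim d W \<longleftrightarrow>
     (\<forall>i\<in>{1..d}. std_brownian (W i)) \<and>
     indep_vars (\<lambda>_. \<Pi>\<^sub>M t\<in>{0..1::real}. (borel :: real measure))
       (\<lambda>i \<omega>. \<lambda>t\<in>{0..1}. W i t \<omega>) {1..d}"

definition brownian_dim :: "nat \<Rightarrow> (nat \<Rightarrow> real \<Rightarrow> 'a \<Rightarrow> real) \<Rightarrow> bool" where
  "brownian_dim d X \<longleftrightarrow>
     (\<exists>k W (A :: nat \<Rightarrow> nat \<Rightarrow> real). std_brownian_dim k W \<and>
        (\<forall>i\<in>{1..d}. \<forall>t\<in>{0..1}. \<forall>\<omega>\<in>space M. X i t \<omega> = (\<Sum>j=1..k. A i j * W j t \<omega>)))"

definition cov :: "('a \<Rightarrow> real) \<Rightarrow> ('a \<Rightarrow> real) \<Rightarrow> real" where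
  "cov X Y = expectation (\<lambda>\<omega>. (X \<omega> - expectation X) * (Y \<omega> - expectation Y))"

definition brownian_with_cov ::
  "nat \<Rightarrow> (nat \<Rightarrow> nat \<Rightarrow> real) \<Rightarrow> (nat \<Rightarrow> real \<Rightarrow> 'a \<Rightarrow> real) \<Rightarrow> bool" where
  "brownian_with_cov d S X \<longleftrightarrow> brownian_dim d X \<and>
     (\<forall>t\<in>{0..1}. \<forall>i\<in>{1..d}. \<forall>j\<in>{1..d}. cov (X i t) (X j t) = t * S i j)"

end

definition tridiag :: "nat \<Rightarrow> nat \<Rightarrow> real" where
  "tridiag i j = (if i = j then 1 else if j = i + 1 \<or> i = j + 1 then - 1 / 2 else 0)"

text \<open>
  In the next two definitions \<open>GREATEST\<close> is the maximum of the displayed set of reals. It is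
  attained when the paths \<open>t \<mapsto> B i t \<omega>\<close> are continuous on \<open>{0..1}\<close>, hence almost surely for
  Brownian motions; for other \<open>\<omega>\<close> the value is unspecified.
\<close>

definition H :: "nat \<Rightarrow> (nat \<Rightarrow> real \<Rightarrow> 'a \<Rightarrow> real) \<Rightarrow> 'a \<Rightarrow> real" where
  "H m B \<omega> = (if m = 1 then 0 else
     sqrt 2 * (- (1 / real m) * (\<Sum>i=1..m-1. real i * B i 1 \<omega>)
       + (GREATEST x. x \<in> {\<Sum>i=1..m-1. B i (t i) \<omega> | t :: nat \<Rightarrow> real.
            (\<forall>i\<in>{1..m-1}. 0 \<le> t i \<and> t i \<le> 1) \<and> (\<forall>i\<in>{1..<m-1}. t i \<le> t (i + 1))})))"

definition D :: "nat \<Rightarrow> (nat \<Rightarrow> real \<Rightarrow> 'a \<Rightarrow> real) \<Rightarrow> 'a \<Rightarrow> real" where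
  "D m B \<omega> =
     (GREATEST x. x \<in> {\<Sum>i=1..m. B i (t i) \<omega> - B i (t (i - 1)) \<omega> | t :: nat \<Rightarrow> real.
        t 0 = 0 \<and> t m = 1 \<and> (\<forall>i\<in>{1..m}. t (i - 1) \<le> t i)})"

definition Z :: "nat \<Rightarrow> (nat \<Rightarrow> real \<Rightarrow> 'a \<Rightarrow> real) \<Rightarrow> 'a \<Rightarrow> real" where
  "Z m B \<omega> = 1 / real m * (\<Sum>i=1..m. B i 1 \<omega>)"

end

theory Submission
  imports Defs
begin

text \<open>
  The Brownian motion \<open>B'\<close> on the same space is the vector of rescaled differences
  \<open>B' i = (B i - B (i + 1)) / sqrt 2\<close>, \<open>1 \<le> i \<le> m - 1\<close>. For it, the identity \<open>D = Z + H\<close> is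
  no probabilistic fact: it holds for every outcome at which the paths are continuous and start
  at 0.

  Indeed, rearranging the sum of increments \<open>B i (t i) - B i (t (i - 1))\<close> by the times at which
  the paths are evaluated turns it into \<open>B m 1 + sqrt 2 * (\<Sum>i. B' i (t i))\<close>
  (\<open>sum_increments_by_parts\<close>), so the sets of competitors in \<open>D\<close> and in \<open>H\<close> are related by an
  increasing affine map (\<open>chain_sums_eq_affine_image\<close>), and so are their greatest elements. These
  exist by compactness of the set of ordered time vectors (\<open>ordered_times_sum_attains_max\<close>).
  The remaining term \<open>B m 1\<close> is \<open>Z\<close> minus the average of the values at time 1 of the weighted
  differences \<open>i * (B i - B (i + 1))\<close> (\<open>sum_weighted_differences\<close>), which is exactly the linear
  correction in \<open>H\<close>.

  Probability enters in two places only. The values \<open>B i t\<close> are independent, centered and of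
  variance \<open>t\<close>, so the covariances of linear combinations are \<open>t\<close> times the inner products of
  the coefficient vectors (\<open>cov_linear_combinations\<close>), and the Gram matrix of the coefficient
  vectors of \<open>B'\<close> is tridiagonal (\<open>diff_matrix_gram\<close>). And \<open>Z\<close> is a multiple of a sum of
  independent normal variables.
\<close>

section \<open>Greatest elements and maxima of path sums\<close>

text \<open>
  Without a greatest element in \<open>S\<close>, the two occurrences of \<open>GREATEST\<close> denote the same unspecified
  number, which the affine map need not fix. This is why attainment of the maximum matters below.
\<close>

lemma Greatest_affine_image:
  fixes S :: "real set"
  assumes "x \<in> S" "\<And>y. y \<in> S \<Longrightarrow> y \<le> x" "c > 0"
  shows "(GREATEST z. z \<in> (\<lambda>y. a + c * y) ` S) = a + c * (GREATEST y. y \<in> S)"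
proof -
  have "(GREATEST y. y \<in> S) = x"
    using assms by (intro Greatest_equality) auto
  moreover have "(GREATEST z. z \<in> (\<lambda>y. a + c * y) ` S) = a + c * x"
    using assms by (intro Greatest_equality) auto
  ultimately show ?thesis by simp
qed

text \<open>
  A continuous function attains its maximum on a compact set. The times are functions on all of
  \<open>nat\<close>, and by Tychonoff's theorem those with every value in \<open>{0..1}\<close> form a compact set. The
  set \<open>S\<close> constrains the coordinates \<open>1, \<dots>, n\<close> only, but the sum does not depend on the other
  coordinates, so they may be set to 0.
\<close>

lemma ordered_times_sum_attains_max:
  fixes f :: "nat \<Rightarrow> real \<Rightarrow> real"
  assumes "\<And>i. i \<in> {1..n} \<Longrightarrow> continuous_on {0..1} (f i)"
  defines "S \<equiv> {\<Sum>i=1..n. f i (t i) | t.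
    (\<forall>i\<in>{1..n}. 0 \<le> t i \<and> t i \<le> 1) \<and> (\<forall>i\<in>{1..<n}. t i \<le> t (i + 1))}"
  shows "\<exists>x\<in>S. \<forall>y\<in>S. y \<le> x"
proof -
  define C where "C = (UNIV :: nat set) \<rightarrow>\<^sub>E {0..1::real}"
  define K where "K = C \<inter> (\<Inter>i\<in>{1..<n}. {t. t i \<le> t (i + 1)})"
  have "compactin (product_topology (\<lambda>i. euclidean) UNIV) C"
    unfolding C_def compactin_PiE by simp
  then have "compact C"
    by (simp add: euclidean_product_topology)
  moreover have "closed (\<Inter>i\<in>{1..<n}. {t :: nat \<Rightarrow> real. t i \<le> t (i + 1)})"
    by (intro closed_INT ballI closed_Collect_le continuous_on_product_coordinates)
  ultimately have "compact K"
    unfolding K_def by (rule compact_Int_closed)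
  moreover have "(\<lambda>i. 0) \<in> K"
    by (auto simp: K_def C_def)
  moreover have "continuous_on K (\<lambda>t. \<Sum>i=1..n. f i (t i))"
  proof (intro continuous_on_sum)
    fix i assume i: "i \<in> {1..n}"
    have "(\<lambda>t. t i) ` K \<subseteq> {0..1}"
      by (auto simp: K_def C_def PiE_iff)
    then show "continuous_on K (\<lambda>t. f i (t i))"
      by (intro continuous_on_compose2[OF assms(1)[OF i]]
          continuous_on_subset[OF continuous_on_product_coordinates]) auto
  qed
  ultimately obtain t where t: "t \<in> K"
    "\<And>s. s \<in> K \<Longrightarrow> (\<Sum>i=1..n. f i (s i)) \<le> (\<Sum>i=1..n. f i (t i))"
    using continuous_attains_sup[of K "\<lambda>t. \<Sum>i=1..n. f i (t i)"] by blast
  have "(\<Sum>i=1..n. f i (t i)) \<in> S"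
    using t(1) by (auto simp: S_def K_def C_def PiE_iff)
  moreover have "y \<le> (\<Sum>i=1..n. f i (t i))" if "y \<in> S" for y
  proof -
    from that obtain s where s: "y = (\<Sum>i=1..n. f i (s i))"
      "\<forall>i\<in>{1..n}. 0 \<le> s i \<and> s i \<le> 1" "\<forall>i\<in>{1..<n}. s i \<le> s (i + 1)"
      unfolding S_def by blast
    define r where "r = (\<lambda>i. if i \<in> {1..n} then s i else 0)"
    have "r \<in> K"
      using s(2,3) by (auto simp: r_def K_def C_def PiE_iff)
    then have "(\<Sum>i=1..n. f i (r i)) \<le> (\<Sum>i=1..n. f i (t i))"
      by (rule t(2))
    then show ?thesis by (simp add: r_def s(1))
  qed
  ultimately show ?thesis by blast
qed

section \<open>The pathwise identity\<close>

text \<open>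
  Summation by parts: each intermediate time \<open>t i\<close> is an end point of the increment of \<open>b i\<close> and a
  starting point of the increment of \<open>b (i + 1)\<close>.
\<close>

lemma sum_increments_by_parts:
  fixes b :: "nat \<Rightarrow> real \<Rightarrow> real"
  assumes "m \<ge> 1"
  shows "(\<Sum>i=1..m. b i (t i) - b i (t (i - 1))) =
    b m (t m) - b 1 (t 0) + (\<Sum>i=1..m-1. b i (t i) - b (i + 1) (t i))"
  using assms
proof (induction m rule: nat_induct_at_least)
  case (Suc n)
  then obtain k where "n = Suc k" by (cases n) auto
  with Suc show ?case by simp
qed simp

lemma sum_weighted_differences:
  fixes x :: "nat \<Rightarrow> real"
  assumes "m \<ge> 1"
  shows "(\<Sum>i=1..m-1. real i * (x i - x (i + 1))) = (\<Sum>i=1..m. x i) - real m * x m"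
  using assms
proof (induction m rule: nat_induct_at_least)
  case (Suc n)
  then obtain k where "n = Suc k" by (cases n) auto
  with Suc show ?case by (simp add: algebra_simps)
qed simp

text \<open>
  The two families of times correspond: a chain from \<open>t 0 = 0\<close> to \<open>t m = 1\<close> has its intermediate
  times in \<open>{0..1}\<close>, and conversely any ordered intermediate times extend to such a chain by these
  two values. Summation by parts relates the two sums.
\<close>

lemma chain_sums_eq_affine_image:
  fixes b b' :: "nat \<Rightarrow> real \<Rightarrow> real"
  assumes m: "m \<ge> 1" and b0: "b 1 0 = 0"
    and b': "\<And>i t. i \<in> {1..m-1} \<Longrightarrow> t \<in> {0..1} \<Longrightarrow> b i t - b (i + 1) t = sqrt 2 * b' i t"
  shows "{\<Sum>i=1..m. b i (t i) - b i (t (i - 1)) | t.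
            t 0 = 0 \<and> t m = 1 \<and> (\<forall>i\<in>{1..m}. t (i - 1) \<le> t i)} =
    (\<lambda>x. b m 1 + sqrt 2 * x) ` {\<Sum>i=1..m-1. b' i (t i) | t :: nat \<Rightarrow> real.
       (\<forall>i\<in>{1..m-1}. 0 \<le> t i \<and> t i \<le> 1) \<and> (\<forall>i\<in>{1..<m-1}. t i \<le> t (i + 1))}"
    (is "?L = ?f ` ?R")
proof -
  have sum_eq: "(\<Sum>i=1..m. b i (t i) - b i (t (i - 1))) = ?f (\<Sum>i=1..m-1. b' i (t i))"
    if "t 0 = 0" "t m = 1" "\<forall>i\<in>{1..m-1}. 0 \<le> t i \<and> t i \<le> 1" for t
  proof -
    have "(\<Sum>i=1..m-1. b i (t i) - b (i + 1) (t i)) = (\<Sum>i=1..m-1. sqrt 2 * b' i (t i))"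
      using that by (intro sum.cong b') auto
    with sum_increments_by_parts[OF m, of b t] that b0 show ?thesis
      by (simp add: sum_distrib_left)
  qed
  show ?thesis
  proof (intro equalityI subsetI)
    fix x assume "x \<in> ?L"
    then obtain t where t: "x = (\<Sum>i=1..m. b i (t i) - b i (t (i - 1)))" "t 0 = 0" "t m = 1"
      "\<forall>i\<in>{1..m}. t (i - 1) \<le> t i"
      by blast
    have step: "t i \<le> t (Suc i)" if "i < m" for i
      using t(4) that by (auto dest: bspec[where x = "Suc i"])
    have mono: "t i \<le> t j" if "i \<le> j" "j \<le> m" for i j
      using that
    proof (induction rule: dec_induct)
      case (step k)
      then show ?case using \<open>\<And>i. i < m \<Longrightarrow> t i \<le> t (Suc i)\<close>[of k] by simp
    qed simp
    have bounds: "\<forall>i\<in>{1..m-1}. 0 \<le> t i \<and> t i \<le> 1"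
      using mono[of 0] mono[of _ m] t(2,3) by fastforce
    have "\<forall>i\<in>{1..<m-1}. t i \<le> t (i + 1)"
      using step by auto
    with bounds have "(\<Sum>i=1..m-1. b' i (t i)) \<in> ?R" by blast
    then show "x \<in> ?f ` ?R"
      using sum_eq[OF t(2,3) bounds] t(1) by blast
  next
    fix x assume "x \<in> ?f ` ?R"
    then obtain t where t: "x = ?f (\<Sum>i=1..m-1. b' i (t i))"
      "\<forall>i\<in>{1..m-1}. 0 \<le> t i \<and> t i \<le> 1" "\<forall>i\<in>{1..<m-1}. t i \<le> t (i + 1)"
      by blast
    define s where "s = t(0 := 0, m := 1)"
    have s: "s 0 = 0" "s m = 1" "\<forall>i\<in>{1..m-1}. 0 \<le> s i \<and> s i \<le> 1"
      using t(2) m by (auto simp: s_def)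
    have "s (i - 1) \<le> s i" if "i \<in> {1..m}" for i
    proof -
      consider "i = m" | "i = 1" "i < m" | "i - 1 \<in> {1..<m-1}"
        using \<open>i \<in> {1..m}\<close> by fastforce
      then show ?thesis
      proof cases
        case 1
        then show ?thesis using s m by (cases "m = 1") auto
      next
        case 2
        then show ?thesis using s by auto
      next
        case 3
        then show ?thesis using bspec[OF t(3) 3] by (auto simp: s_def)
      qed
    qed
    moreover have "(\<Sum>i=1..m-1. b' i (t i)) = (\<Sum>i=1..m-1. b' i (s i))"
      by (intro sum.cong) (auto simp: s_def)
    ultimately have "x = (\<Sum>i=1..m. b i (s i) - b i (s (i - 1)))" "\<forall>i\<in>{1..m}. s (i - 1) \<le> s i"
      using sum_eq[OF s] t(1) by auto
    with s(1,2) show "x \<in> ?L" by blast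
  qed
qed

text \<open>
  This is the identity of the theorem for a single outcome. With \<open>G\<close> the maximum in \<open>H\<close>, it amounts
  to \<open>D = B m 1 + sqrt 2 * G\<close> and \<open>H = - (Z - B m 1) + sqrt 2 * G\<close>.
\<close>

lemma D_eq_Z_plus_H_pathwise:
  fixes B B' :: "nat \<Rightarrow> real \<Rightarrow> 'a \<Rightarrow> real"
  assumes m: "m \<ge> 1" and B0: "B 1 0 \<omega> = 0"
    and cont: "\<And>i. i \<in> {1..m} \<Longrightarrow> continuous_on {0..1} (\<lambda>t. B i t \<omega>)"
    and B': "\<And>i t. i \<in> {1..m-1} \<Longrightarrow> t \<in> {0..1} \<Longrightarrow> B' i t \<omega> = (B i t \<omega> - B (i + 1) t \<omega>) / sqrt 2"
  shows "D m B \<omega> = Z m B \<omega> + H m B' \<omega>"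
proof -
  define R where "R = {\<Sum>i=1..m-1. B' i (t i) \<omega> | t :: nat \<Rightarrow> real.
       (\<forall>i\<in>{1..m-1}. 0 \<le> t i \<and> t i \<le> 1) \<and> (\<forall>i\<in>{1..<m-1}. t i \<le> t (i + 1))}"
  define G where "G = (GREATEST x. x \<in> R)"
  have "continuous_on {0..1} (\<lambda>t. B' i t \<omega>)" if "i \<in> {1..m-1}" for i
  proof -
    have "continuous_on {0..1} (\<lambda>t. (B i t \<omega> - B (i + 1) t \<omega>) / sqrt 2)"
      using that by (intro continuous_intros cont) auto
    then show ?thesis
      by (rule continuous_on_cong[THEN iffD1, rotated -1]) (simp_all add: B'[OF that])
  qed
  then obtain x where x: "x \<in> R" "\<And>y. y \<in> R \<Longrightarrow> y \<le> x"
    using ordered_times_sum_attains_max[of "m - 1" "\<lambda>i t. B' i t \<omega>"] unfolding R_def by blast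
  have D: "D m B \<omega> = B m 1 \<omega> + sqrt 2 * G"
  proof -
    have "D m B \<omega> = (GREATEST z. z \<in> (\<lambda>y. B m 1 \<omega> + sqrt 2 * y) ` R)"
      unfolding D_def R_def
      using B' by (subst chain_sums_eq_affine_image[of m "\<lambda>i t. B i t \<omega>" "\<lambda>i t. B' i t \<omega>"])
        (use m B0 in auto)
    also have "\<dots> = B m 1 \<omega> + sqrt 2 * G"
      unfolding G_def using x by (rule Greatest_affine_image) auto
    finally show ?thesis .
  qed
  have H: "H m B' \<omega> = sqrt 2 * (- (1 / real m) * (\<Sum>i=1..m-1. real i * B' i 1 \<omega>) + G)"
  proof (cases "m = 1")
    \<comment> \<open>For \<open>m = 1\<close> the general formula agrees with the convention that \<open>H\<close> vanishes: the only
       competitor in the maximum is the empty sum.\<close>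
    case True
    then have "R = {0}" by (auto simp: R_def)
    then have "G = 0" unfolding G_def by (intro Greatest_equality) auto
    with True show ?thesis by (simp add: H_def)
  qed (simp add: H_def G_def R_def)
  have "sqrt 2 * (\<Sum>i=1..m-1. real i * B' i 1 \<omega>)
      = (\<Sum>i=1..m-1. real i * (B i 1 \<omega> - B (i + 1) 1 \<omega>))"
    unfolding sum_distrib_left by (intro sum.cong) (auto simp: B')
  also have "\<dots> = real m * (Z m B \<omega> - B m 1 \<omega>)"
    using sum_weighted_differences[OF m, of "\<lambda>i. B i 1 \<omega>"] m
    by (simp add: Z_def right_diff_distrib)
  finally have "(1 / real m) * (sqrt 2 * (\<Sum>i=1..m-1. real i * B' i 1 \<omega>)) = Z m B \<omega> - B m 1 \<omega>"
    using m by simp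
  with D H show ?thesis by (simp add: algebra_simps)
qed

section \<open>Moments of Brownian motion\<close>

context prob_space
begin

lemma distributed_cong_AE:
  assumes "distributed M N X f" "AE \<omega> in M. X \<omega> = Y \<omega>" "Y \<in> measurable M N"
  shows "distributed M N Y f"
  using assms distr_cong_AE[of M M N N X Y] by (auto simp: distributed_def)

text \<open>
  Brownian motion is specified by its increments and starts at 0 almost surely, so its value at
  time \<open>t\<close> agrees almost surely with the increment from 0 to \<open>t\<close>.
\<close>

lemma std_brownian_distributed:
  assumes "std_brownian W" "0 < t" "t \<le> 1"
  shows "distributed M lborel (W t) (normal_density 0 (sqrt t))"
proof (rule distributed_cong_AE)
  show "distributed M lborel (\<lambda>\<omega>. W t \<omega> - W 0 \<omega>) (normal_density 0 (sqrt t))"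
    using assms unfolding std_brownian_def by fastforce
  show "AE \<omega> in M. W t \<omega> - W 0 \<omega> = W t \<omega>"
    using assms unfolding std_brownian_def by auto
  show "W t \<in> measurable M lborel"
    using assms unfolding std_brownian_def by auto
qed

lemma std_brownian_moments:
  assumes W: "std_brownian W" and t: "t \<in> {0..1}"
  shows "integrable M (W t)" "expectation (W t) = 0"
    "integrable M (\<lambda>\<omega>. (W t \<omega>)\<^sup>2)" "expectation (\<lambda>\<omega>. (W t \<omega>)\<^sup>2) = t"
proof -
  have "integrable M (W t) \<and> expectation (W t) = 0 \<and>
    integrable M (\<lambda>\<omega>. (W t \<omega>)\<^sup>2) \<and> expectation (\<lambda>\<omega>. (W t \<omega>)\<^sup>2) = t"
  proof (cases "t = 0")
    \<comment> \<open>At time 0 the normal density degenerates; the value is almost surely 0 instead.\<close>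
    case True
    have ae: "AE \<omega> in M. W t \<omega> = 0" and [measurable]: "W t \<in> borel_measurable M"
      using W t True unfolding std_brownian_def by auto
    have "integrable M (\<lambda>\<omega>. W t \<omega> ^ n) \<and> expectation (\<lambda>\<omega>. W t \<omega> ^ n) = 0" if "n > 0" for n
    proof -
      have "AE \<omega> in M. W t \<omega> ^ n = 0" using ae that by (auto simp: zero_power)
      then have "integrable M (\<lambda>\<omega>. W t \<omega> ^ n) = integrable M (\<lambda>_. 0 :: real)"
        "expectation (\<lambda>\<omega>. W t \<omega> ^ n) = expectation (\<lambda>_. 0)"
        by (intro integrable_cong_AE integral_cong_AE; simp)+
      then show ?thesis by simp
    qed
    from this[of 1] this[of 2] True show ?thesis by simp
  next
    case False
    with t have pos: "0 < t" "0 < sqrt t" and d: "distributed M lborel (W t) (normal_density 0 (sqrt t))"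
      using std_brownian_distributed[OF W] by auto
    have e: "expectation (W t) = 0"
      using normal_distributed_expectation[OF pos(2) d] .
    have "integrable M (W t)"
      using distributed_integrable[OF d, of "\<lambda>x. x"] integrable_normal_moment_nz_1[OF pos(2), of 0]
      by simp
    moreover have "integrable M (\<lambda>\<omega>. (W t \<omega>)\<^sup>2)"
      using distributed_integrable[OF d, of "\<lambda>x. x\<^sup>2"] integrable_normal_moment[OF pos(2), of 0 2]
      by simp
    ultimately show ?thesis
      using e normal_distributed_variance[OF pos(2) d] pos by simp
  qed
  then show "integrable M (W t)" "expectation (W t) = 0"
    "integrable M (\<lambda>\<omega>. (W t \<omega>)\<^sup>2)" "expectation (\<lambda>\<omega>. (W t \<omega>)\<^sup>2) = t"
    by auto
qed

text \<open>Evaluation at a fixed time is measurable on the path space.\<close>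

lemma std_brownian_dim_indep_at:
  assumes "std_brownian_dim d W" "t \<in> {0..1}"
  shows "indep_vars (\<lambda>_. borel) (\<lambda>i. W i t) {1..d}"
proof -
  have "indep_vars (\<lambda>_. \<Pi>\<^sub>M t\<in>{0..1::real}. (borel :: real measure))
       (\<lambda>i \<omega>. \<lambda>t\<in>{0..1}. W i t \<omega>) {1..d}"
    using assms by (simp add: std_brownian_dim_def)
  then have "indep_vars (\<lambda>_. borel) (\<lambda>i \<omega>. (\<lambda>p. p t) (\<lambda>t\<in>{0..1}. W i t \<omega>)) {1..d}"
    by (rule indep_vars_compose2) (use assms in measurable)
  then show ?thesis using assms by (simp cong: indep_vars_cong)
qed

lemma std_brownian_dim_product_moment:
  assumes W: "std_brownian_dim d W" and t: "t \<in> {0..1}" and i: "i \<in> {1..d}" and j: "j \<in> {1..d}"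
  shows "integrable M (\<lambda>\<omega>. W i t \<omega> * W j t \<omega>)"
    "expectation (\<lambda>\<omega>. W i t \<omega> * W j t \<omega>) = (if i = j then t else 0)"
proof -
  have bm: "std_brownian (W k)" if "k \<in> {1..d}" for k
    using W that by (simp add: std_brownian_dim_def)
  have "integrable M (\<lambda>\<omega>. W i t \<omega> * W j t \<omega>) \<and>
    expectation (\<lambda>\<omega>. W i t \<omega> * W j t \<omega>) = (if i = j then t else 0)"
  proof (cases "i = j")
    case True
    then show ?thesis
      using std_brownian_moments(3,4)[OF bm[OF i] t] by (simp add: power2_eq_square)
  next
    case False
    have ind: "indep_vars (\<lambda>_. borel) (\<lambda>i. W i t) {i, j}"
      by (rule indep_vars_subset[OF std_brownian_dim_indep_at[OF W t]]) (use i j in auto)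
    have int: "\<And>k. k \<in> {i, j} \<Longrightarrow> integrable M (W k t)"
      using std_brownian_moments(1)[OF bm t] i j by auto
    show ?thesis
      using indep_vars_lebesgue_integral[OF _ ind int] indep_vars_integrable[OF _ ind int] False
        std_brownian_moments(2)[OF bm[OF i] t] by simp
  qed
  then show "integrable M (\<lambda>\<omega>. W i t \<omega> * W j t \<omega>)"
    "expectation (\<lambda>\<omega>. W i t \<omega> * W j t \<omega>) = (if i = j then t else 0)"
    by auto
qed

text \<open>
  By bilinearity only the second moments of the components matter, and these are \<open>t\<close> times the
  identity matrix.
\<close>

lemma cov_linear_combinations:
  assumes W: "std_brownian_dim d W" and t: "t \<in> {0..1}"
  shows "cov (\<lambda>\<omega>. \<Sum>k=1..d. a k * W k t \<omega>) (\<lambda>\<omega>. \<Sum>k=1..d. b k * W k t \<omega>) =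
    t * (\<Sum>k=1..d. a k * b k)"
proof -
  have mean: "expectation (\<lambda>\<omega>. \<Sum>k=1..d. c k * W k t \<omega>) = 0" for c
  proof -
    have "expectation (\<lambda>\<omega>. \<Sum>k=1..d. c k * W k t \<omega>) = (\<Sum>k=1..d. c k * expectation (W k t))"
      using std_brownian_moments(1)[OF _ t] W
      by (subst Bochner_Integration.integral_sum) (auto simp: std_brownian_dim_def)
    also have "\<dots> = 0"
      using std_brownian_moments(2)[OF _ t] W
      by (intro sum.neutral) (auto simp: std_brownian_dim_def)
    finally show ?thesis .
  qed
  note pm = std_brownian_dim_product_moment[OF W t]
  have "cov (\<lambda>\<omega>. \<Sum>k=1..d. a k * W k t \<omega>) (\<lambda>\<omega>. \<Sum>k=1..d. b k * W k t \<omega>) =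
    expectation (\<lambda>\<omega>. \<Sum>k=1..d. \<Sum>l=1..d. a k * b l * (W k t \<omega> * W l t \<omega>))"
    unfolding cov_def mean by (simp add: sum_product mult_ac)
  also have "\<dots> = (\<Sum>k=1..d. \<Sum>l=1..d. a k * b l * expectation (\<lambda>\<omega>. W k t \<omega> * W l t \<omega>))"
  proof -
    have "expectation (\<lambda>\<omega>. \<Sum>k=1..d. \<Sum>l=1..d. a k * b l * (W k t \<omega> * W l t \<omega>)) =
        (\<Sum>k=1..d. expectation (\<lambda>\<omega>. \<Sum>l=1..d. a k * b l * (W k t \<omega> * W l t \<omega>)))"
      by (intro Bochner_Integration.integral_sum Bochner_Integration.integrable_sum
          integrable_mult_right pm(1))
    also have "\<dots> = (\<Sum>k=1..d. \<Sum>l=1..d. expectation (\<lambda>\<omega>. a k * b l * (W k t \<omega> * W l t \<omega>)))"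
      by (intro sum.cong refl Bochner_Integration.integral_sum integrable_mult_right pm(1))
    finally show ?thesis by simp
  qed
  also have "\<dots> = (\<Sum>k=1..d. \<Sum>l=1..d. if k = l then a k * b l * t else 0)"
    using pm(2) by (intro sum.cong) auto
  also have "\<dots> = t * (\<Sum>k=1..d. a k * b k)"
    by (simp add: sum.delta sum_distrib_left mult_ac)
  finally show ?thesis .
qed

lemma Z_distributed:
  assumes m: "m \<ge> 1" and W: "std_brownian_dim m W"
  shows "distributed M lborel (Z m W) (normal_density 0 (sqrt (1 / real m)))"
proof -
  have "distributed M lborel (\<lambda>\<omega>. \<Sum>i\<in>{1..m}. W i 1 \<omega>)
      (normal_density (\<Sum>i\<in>{1..m}. 0) (sqrt (\<Sum>i\<in>{1..m}. 1\<^sup>2)))"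
  proof (rule sum_indep_normal)
    show "distributed M lborel (W i 1) (normal_density 0 1)" if "i \<in> {1..m}" for i
      using std_brownian_distributed[of "W i" 1] W that by (simp add: std_brownian_dim_def)
    show "indep_vars (\<lambda>_. borel) (\<lambda>i. W i 1) {1..m}"
      using std_brownian_dim_indep_at[OF W, of 1] by simp
  qed (use m in auto)
  then have "distributed M lborel (\<lambda>\<omega>. \<Sum>i=1..m. W i 1 \<omega>) (normal_density 0 (sqrt (real m)))"
    by simp
  from normal_density_affine[OF this, of "1 / real m" 0]
  have "distributed M lborel (Z m W) (normal_density 0 (1 / real m * sqrt (real m)))"
    using m by (simp add: Z_def[abs_def])
  moreover have "1 / real m * sqrt (real m) = sqrt (1 / real m)"
    using m by (simp add: real_sqrt_divide field_simps)
  ultimately show ?thesis by simp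
qed

end

section \<open>The rescaled differences\<close>

text \<open>
  The differences are written as a linear transformation of \<open>B\<close>, the form in which
  multidimensional Brownian motions are defined.
\<close>

definition diff_matrix :: "nat \<Rightarrow> nat \<Rightarrow> real" where
  "diff_matrix i j = (if j = i then 1 / sqrt 2 else if j = i + 1 then - 1 / sqrt 2 else 0)"

lemma sum_diff_matrix:
  assumes "i \<in> {1..m-1}"
  shows "(\<Sum>k=1..m. diff_matrix i k * x k) = (x i - x (i + 1)) / sqrt 2"
proof -
  have "(\<Sum>k=1..m. diff_matrix i k * x k) =
      (\<Sum>k=1..m. (if k = i then x k / sqrt 2 else 0) - (if k = i + 1 then x k / sqrt 2 else 0))"
    by (intro sum.cong) (auto simp: diff_matrix_def)
  also have "\<dots> = (x i - x (i + 1)) / sqrt 2"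
    using assms by (subst sum_subtractf, subst (1 2) sum.delta) (auto simp: diff_divide_distrib)
  finally show ?thesis .
qed

text \<open>
  The product with row \<open>i\<close> takes a scaled difference of two neighbouring entries of row \<open>j\<close>, each of
  which is 0 or one of \<open>1 / sqrt 2\<close> and \<open>- 1 / sqrt 2\<close>.
\<close>

lemma diff_matrix_gram:
  assumes "i \<in> {1..m-1}"
  shows "(\<Sum>k=1..m. diff_matrix i k * diff_matrix j k) = tridiag i j"
  unfolding sum_diff_matrix[OF assms] by (auto simp: diff_matrix_def tridiag_def)

theorem theorem4p1:
  fixes M :: "'a measure" and m :: nat and B :: "nat \<Rightarrow> real \<Rightarrow> 'a \<Rightarrow> real"
  assumes "prob_space M"
    and "m \<ge> 1"
    and "prob_space.std_brownian_dim M m B"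
  shows "distributed M lborel (Z m B) (normal_density 0 (sqrt (1 / real m))) \<and>
    (\<exists>B' :: nat \<Rightarrow> real \<Rightarrow> 'a \<Rightarrow> real.
       prob_space.brownian_with_cov M (m - 1) tridiag B' \<and>
       (AE \<omega> in M. D m B \<omega> = Z m B \<omega> + H m B' \<omega>))"
proof -
  interpret prob_space M by fact
  define B' where "B' = (\<lambda>i t \<omega>. \<Sum>j=1..m. diff_matrix i j * B j t \<omega>)"
  have "brownian_dim (m - 1) B'"
    unfolding brownian_dim_def B'_def using assms(3) by blast
  moreover have "cov (B' i t) (B' j t) = t * tridiag i j"
    if "t \<in> {0..1}" "i \<in> {1..m-1}" for t i j
    unfolding B'_def cov_linear_combinations[OF assms(3) that(1)] diff_matrix_gram[OF that(2)] ..
  ultimately have "brownian_with_cov (m - 1) tridiag B'"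
    by (simp add: brownian_with_cov_def)
  moreover have "AE \<omega> in M. D m B \<omega> = Z m B \<omega> + H m B' \<omega>"
  proof -
    have "AE \<omega> in M. \<forall>i\<in>{1..m}. B i 0 \<omega> = 0 \<and> continuous_on {0..1} (\<lambda>t. B i t \<omega>)"
      using assms(3) by (intro AE_finite_allI) (auto simp: std_brownian_dim_def std_brownian_def)
    then show ?thesis
    proof eventually_elim
      case (elim \<omega>)
      show ?case
      proof (rule D_eq_Z_plus_H_pathwise)
        show "B' i t \<omega> = (B i t \<omega> - B (i + 1) t \<omega>) / sqrt 2" if "i \<in> {1..m-1}" for i t
          unfolding B'_def using that by (rule sum_diff_matrix)
      qed (use elim assms(2) in auto)
    qed
  qed
  ultimately show ?thesis
    using Z_distributed[OF assms(2,3)] by blast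
qed

end
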